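(* Let $\Bbbk$ be a field, $S=\Bbbk[x_0,\ldots,x_n]$, let $I\subseteq S$ be an ideal of projective dimension zero and $R=S/I$. Let $e_1,\ldots,e_m\in S$ be forms of degree $\mathrm{nz}(R)$ such that $\{[e_1],\ldots,[e_m]\}$ is a $\Bbbk$-basis of $R_{\mathrm{nz}(R)}$. Suppose that $R^u$ has a non-zero divisor of degree one, represented by $l\in S_1$. Then $\{[e_1l^i],\ldots,[e_ml^i]\}$ is a $\Bbbk$-basis of $R_{\mathrm{nz}(R)+i}$ for all positive integers $i$. Moreover, for each $j\in\{0,\ldots,n\}$, the multiplication matrix $A_j$ representing the map $R_{\mathrm{nz}(R)+i}\to R_{\mathrm{nz}(R)+i+1}$, $[a]\mapsto[x_ja]$, with respect to the bases $\{[e_kl^i]\}_k$ and $\{[e_kl^{i+1}]\}_k$, is independent of the choice of $i\ge 0$.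
   Context: An ideal $I\subseteq S=\Bbbk[x_0,\ldots,x_n]$ is of projective dimension zero if $R=S/I$ is graded (i.e. $I$ is homogeneous) and there is $m>0$ with $\dim_\Bbbk R_i=m$ for all sufficiently large $i$. For such a ring, $\mathrm{post}(R)$ is the least $i$ such that $\dim_\Bbbk R_i=\dim_\Bbbk R_{i+1}=\cdots$. Taking a minimal primary decomposition of $I$, $I^u$ denotes the intersection of those primary components whose radical is not $\mathfrak m=(x_0,\ldots,x_n)$, and $R^u=S/I^u$. Set $\mathrm{nz}(R)=\max(\mathrm{post}(R),\mathrm{post}(R^u))$. $[a]$ denotes the class of $a\in S$ in the quotient ring. The matrix of a linear map $\phi:V\to W$ with respect to bases $v_1,\dots,v_m$ and $w_1,\dots,w_{m'}$ is the $m\times m'$ matrix whose $k$-th row is the coefficient vector of $\phi(v_k)$ in terms of $w_1,\dots,w_{m'}$. *)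

theory Defs
  imports
    "HOL-Library.Poly_Mapping"
    "HOL-Algebra.QuotRing"
    "HOL-Algebra.Embedded_Algebras"
    "Jordan_Normal_Form.Matrix"
begin

section \<open>Polynomial rings in finitely many variables\<close>

text \<open>A monomial is a finitely supported exponent vector; the index \<open>v\<close> stands for \<open>x\<^sub>v\<close>.\<close>

type_synonym 'k mpoly = "(nat \<Rightarrow>\<^sub>0 nat) \<Rightarrow>\<^sub>0 'k"

definition mpoly_ring :: "nat \<Rightarrow> 'k::field mpoly ring" where
  "mpoly_ring n =
     \<lparr>carrier = {p. \<forall>t \<in> Poly_Mapping.keys p. Poly_Mapping.keys t \<subseteq> {0..n}},
      monoid.mult = (*), one = 1, zero = 0, add = (+)\<rparr>"

definition mconst :: "'k::field \<Rightarrow> 'k mpoly" where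
  "mconst c = Poly_Mapping.single 0 c"

definition mvar :: "nat \<Rightarrow> 'k::field mpoly" where
  "mvar j = Poly_Mapping.single (Poly_Mapping.single j 1) 1"

definition monom_degree :: "(nat \<Rightarrow>\<^sub>0 nat) \<Rightarrow> nat" where
  "monom_degree t = (\<Sum>v \<in> Poly_Mapping.keys t. Poly_Mapping.lookup t v)"

text \<open>\<open>forms n d\<close> is the graded piece \<open>S\<^sub>d\<close>; as a vector space it contains \<open>0\<close>.\<close>

definition forms :: "nat \<Rightarrow> nat \<Rightarrow> 'k::field mpoly set" where
  "forms n d = {p \<in> carrier (mpoly_ring n). \<forall>t \<in> Poly_Mapping.keys p. monom_degree t = d}"

definition irrelevant_ideal :: "nat \<Rightarrow> 'k::field mpoly set" where
  "irrelevant_ideal n = Idl\<^bsub>mpoly_ring n\<^esub> (mvar ` {0..n})"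

definition homogeneous_ideal :: "nat \<Rightarrow> 'k::field mpoly set \<Rightarrow> bool" where
  "homogeneous_ideal n I \<longleftrightarrow>
     (\<exists>G \<subseteq> (\<Union>d. forms n d). I = Idl\<^bsub>mpoly_ring n\<^esub> G)"

lemma mpoly_ring_cring: "cring (mpoly_ring n :: 'k::field mpoly ring)"
proof -
  let ?C = "carrier (mpoly_ring n :: 'k mpoly ring)"
  have C: "?C = {p. \<forall>t \<in> Poly_Mapping.keys p. Poly_Mapping.keys t \<subseteq> {0..n}}"
    by (simp add: mpoly_ring_def)
  have add: "p + q \<in> ?C" if "p \<in> ?C" "q \<in> ?C" for p q :: "'k mpoly"
    using that Poly_Mapping.keys_add[of p q] unfolding C by blast
  have mult: "p * q \<in> ?C" if "p \<in> ?C" "q \<in> ?C" for p q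
    unfolding C
  proof (intro CollectI ballI)
    fix t assume "t \<in> Poly_Mapping.keys (p * q)"
    then obtain a b where "t = a + b" "a \<in> Poly_Mapping.keys p" "b \<in> Poly_Mapping.keys q"
      using Poly_Mapping.keys_mult[of p q] by blast
    then show "Poly_Mapping.keys t \<subseteq> {0..n}"
      using that Poly_Mapping.keys_add[of a b] unfolding C by blast
  qed
  have uminus: "- p \<in> ?C" if "p \<in> ?C" for p
    using that unfolding C by simp
  have zero: "0 \<in> ?C" and one: "1 \<in> ?C"
    unfolding C by simp_all
  have ops: "p \<otimes>\<^bsub>mpoly_ring n\<^esub> q = p * q" "p \<oplus>\<^bsub>mpoly_ring n\<^esub> q = p + q"
      "\<zero>\<^bsub>mpoly_ring n\<^esub> = 0" "\<one>\<^bsub>mpoly_ring n\<^esub> = 1"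
    for p q :: "'k mpoly"
    by (simp_all add: mpoly_ring_def)
  show ?thesis
  proof (rule cringI)
    show "abelian_group (mpoly_ring n :: 'k mpoly ring)"
    proof (rule abelian_groupI)
      fix p :: "'k mpoly" assume "p \<in> ?C"
      then show "\<exists>q \<in> ?C. q \<oplus>\<^bsub>mpoly_ring n\<^esub> p = \<zero>\<^bsub>mpoly_ring n\<^esub>"
        using uminus[of p] by (intro bexI[of _ "- p"]) (auto simp: ops)
    qed (use add zero in \<open>simp_all add: ops ac_simps\<close>)
    show "comm_monoid (mpoly_ring n :: 'k mpoly ring)"
      by (rule comm_monoidI) (use mult one in \<open>simp_all add: ops ac_simps\<close>)
  qed (simp add: ops distrib_right)
qed


section \<open>Primary decomposition\<close>

definition radical :: "('a, 'b) ring_scheme \<Rightarrow> 'a set \<Rightarrow> 'a set" where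
  "radical R I = {a \<in> carrier R. \<exists>k::nat. a [^]\<^bsub>R\<^esub> k \<in> I}"

definition primary_ideal :: "'a set \<Rightarrow> ('a, 'b) ring_scheme \<Rightarrow> bool" where
  "primary_ideal Q R \<longleftrightarrow> ideal Q R \<and> Q \<noteq> carrier R \<and>
     (\<forall>a \<in> carrier R. \<forall>b \<in> carrier R. a \<otimes>\<^bsub>R\<^esub> b \<in> Q \<longrightarrow> a \<in> Q \<or> b \<in> radical R Q)"

text \<open>Intersection within \<open>R\<close>, so that the empty family yields the unit ideal.\<close>

definition ideal_Inter :: "('a, 'b) ring_scheme \<Rightarrow> 'a set set \<Rightarrow> 'a set" where
  "ideal_Inter R \<Q> = carrier R \<inter> \<Inter> \<Q>"

definition minimal_primary_decomposition ::
    "('a, 'b) ring_scheme \<Rightarrow> 'a set \<Rightarrow> 'a set set \<Rightarrow> bool" where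
  "minimal_primary_decomposition R I \<Q> \<longleftrightarrow>
     finite \<Q> \<and> (\<forall>Q \<in> \<Q>. primary_ideal Q R) \<and>
     I = ideal_Inter R \<Q> \<and>
     inj_on (radical R) \<Q> \<and>
     (\<forall>Q \<in> \<Q>. ideal_Inter R (\<Q> - {Q}) \<noteq> I)"

text \<open>
  \<open>upper_part n \<Q>\<close> is \<open>I\<^sup>u\<close>, computed from a minimal primary decomposition \<open>\<Q>\<close> of \<open>I\<close>. It does
  not depend on the decomposition: the irrelevant ideal is maximal, hence the associated primes
  different from it form an isolated set.
\<close>

definition upper_part :: "nat \<Rightarrow> 'k::field mpoly set set \<Rightarrow> 'k mpoly set" where
  "upper_part n \<Q> =
     ideal_Inter (mpoly_ring n) {Q \<in> \<Q>. radical (mpoly_ring n) Q \<noteq> irrelevant_ideal n}"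


section \<open>Graded quotients\<close>

abbreviation quot :: "nat \<Rightarrow> 'k::field mpoly set \<Rightarrow> 'k mpoly set ring" where
  "quot n I \<equiv> mpoly_ring n Quot I"

definition cls :: "nat \<Rightarrow> 'k::field mpoly set \<Rightarrow> 'k mpoly \<Rightarrow> 'k mpoly set" where
  "cls n I a = I +>\<^bsub>mpoly_ring n\<^esub> a"

text \<open>
  The \<open>k\<close>-vector space structure of \<open>R = S/I\<close> is expressed through the image of \<open>k\<close> in \<open>R\<close>, which
  is a subfield isomorphic to \<open>k\<close> whenever \<open>I\<close> is proper.
\<close>

definition scalars :: "nat \<Rightarrow> 'k::field mpoly set \<Rightarrow> 'k mpoly set set" where
  "scalars n I = range (\<lambda>c. cls n I (mconst c))"

definition piece :: "nat \<Rightarrow> 'k::field mpoly set \<Rightarrow> nat \<Rightarrow> 'k mpoly set set" where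
  "piece n I d = cls n I ` forms n d"

definition hilbert :: "nat \<Rightarrow> 'k::field mpoly set \<Rightarrow> nat \<Rightarrow> nat" where
  "hilbert n I d = ring.dim (quot n I) (scalars n I) (piece n I d)"

definition is_basis :: "nat \<Rightarrow> 'k::field mpoly set \<Rightarrow> 'k mpoly set list \<Rightarrow> 'k mpoly set set \<Rightarrow> bool"
  where
  "is_basis n I vs V \<longleftrightarrow>
     ring.independent (quot n I) (scalars n I) vs \<and> ring.Span (quot n I) (scalars n I) vs = V"

definition projective_dim_zero :: "nat \<Rightarrow> 'k::field mpoly set \<Rightarrow> bool" where
  "projective_dim_zero n I \<longleftrightarrow>
     ideal I (mpoly_ring n) \<and> homogeneous_ideal n I \<and>
     (\<exists>m > 0. \<exists>N. \<forall>i \<ge> N. hilbert n I i = m)"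

definition post :: "nat \<Rightarrow> 'k::field mpoly set \<Rightarrow> nat" where
  "post n I = (LEAST i. \<forall>j \<ge> i. hilbert n I j = hilbert n I i)"

definition nz :: "nat \<Rightarrow> 'k::field mpoly set \<Rightarrow> 'k mpoly set set \<Rightarrow> nat" where
  "nz n I \<Q> = max (post n I) (post n (upper_part n \<Q>))"

definition non_zero_divisor :: "('a, 'b) ring_scheme \<Rightarrow> 'a \<Rightarrow> bool" where
  "non_zero_divisor R a \<longleftrightarrow>
     a \<in> carrier R \<and> (\<forall>r \<in> carrier R. a \<otimes>\<^bsub>R\<^esub> r = \<zero>\<^bsub>R\<^esub> \<longrightarrow> r = \<zero>\<^bsub>R\<^esub>)"

text \<open>Row convention: the \<open>r\<close>-th row of \<open>A\<close> holds the coordinates of \<open>\<phi> (vs ! r)\<close> in \<open>ws\<close>.\<close>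

definition represents ::
    "nat \<Rightarrow> 'k::field mpoly set \<Rightarrow> 'k mat \<Rightarrow> ('k mpoly set \<Rightarrow> 'k mpoly set) \<Rightarrow>
     'k mpoly set list \<Rightarrow> 'k mpoly set list \<Rightarrow> bool" where
  "represents n I A \<phi> vs ws \<longleftrightarrow>
     A \<in> carrier_mat (length vs) (length ws) \<and>
     (\<forall>r < length vs.
        \<phi> (vs ! r) =
          ring.combine (quot n I) (map (\<lambda>c. cls n I (mconst c)) (list_of_vec (row A r))) ws)"

text \<open>The map \<open>[a] \<mapsto> [x\<^sub>j a]\<close>, i.e. multiplication by \<open>[x\<^sub>j]\<close> in \<open>S/I\<close>.\<close>

definition mult_var :: "nat \<Rightarrow> 'k::field mpoly set \<Rightarrow> nat \<Rightarrow> 'k mpoly set \<Rightarrow> 'k mpoly set" where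
  "mult_var n I j r = cls n I (mvar j) \<otimes>\<^bsub>quot n I\<^esub> r"

definition shifted_basis ::
    "nat \<Rightarrow> 'k::field mpoly set \<Rightarrow> 'k mpoly list \<Rightarrow> 'k mpoly \<Rightarrow> nat \<Rightarrow> 'k mpoly set list" where
  "shifted_basis n I es l i = map (\<lambda>e. cls n I (e * l ^ i)) es"

end

(* Let J be the upper part of I. A power of the irrelevant ideal lies in the primary component
   belonging to it (if any), so I and J agree in large degrees, and their Hilbert functions have the
   same eventual value m. From degree nz on both Hilbert functions equal m, so there I and J contain
   the same forms. Multiplication by l^i is injective modulo J, hence the m elements e_k l^i are
   independent modulo I in a piece of dimension m. A matrix for x_j at i = 0 encodes congruences
   x_j e_r = sum_s A_rs e_s l modulo I; multiplying them by l^i shows that it works for all i. *)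
theory Submission
  imports Defs
begin

section \<open>Polynomials and forms\<close>

lemma mpoly_ring_sel [simp]:
  "p \<otimes>\<^bsub>mpoly_ring n\<^esub> q = p * q"
  "p \<oplus>\<^bsub>mpoly_ring n\<^esub> q = p + q"
  "\<zero>\<^bsub>mpoly_ring n\<^esub> = 0"
  "\<one>\<^bsub>mpoly_ring n\<^esub> = 1"
  by (simp_all add: mpoly_ring_def)

lemma mpoly_ring_pow [simp]: "p [^]\<^bsub>mpoly_ring n\<^esub> (k::nat) = p ^ k"
proof -
  interpret cring "mpoly_ring n" by (rule mpoly_ring_cring)
  show ?thesis by (induction k) (simp_all add: mult.commute)
qed

lemma carrier_mpoly_iff:
  "p \<in> carrier (mpoly_ring n) \<longleftrightarrow> (\<forall>t \<in> Poly_Mapping.keys p. Poly_Mapping.keys t \<subseteq> {0..n})"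
  by (simp add: mpoly_ring_def)

lemma carrier_mpoly_mult:
  "\<lbrakk>p \<in> carrier (mpoly_ring n); q \<in> carrier (mpoly_ring n)\<rbrakk> \<Longrightarrow> p * q \<in> carrier (mpoly_ring n)"
proof -
  interpret cring "mpoly_ring n" by (rule mpoly_ring_cring)
  show "\<lbrakk>p \<in> carrier (mpoly_ring n); q \<in> carrier (mpoly_ring n)\<rbrakk> \<Longrightarrow> p * q \<in> carrier (mpoly_ring n)"
    using m_closed[of p q] by simp
qed

lemma mpoly_ring_a_inv:
  assumes "p \<in> carrier (mpoly_ring n)"
  shows "\<ominus>\<^bsub>mpoly_ring n\<^esub> p = - p"
proof -
  interpret cring "mpoly_ring n" by (rule mpoly_ring_cring)
  have "\<ominus>\<^bsub>mpoly_ring n\<^esub> p + p = 0"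
    using l_neg[OF assms] by simp
  then show ?thesis by (simp add: eq_neg_iff_add_eq_0)
qed

lemma mpoly_ring_a_minus:
  "q \<in> carrier (mpoly_ring n) \<Longrightarrow> p \<ominus>\<^bsub>mpoly_ring n\<^esub> q = p - q"
  by (simp add: a_minus_def mpoly_ring_a_inv)

lemma ideal_mpoly_closed:
  assumes "ideal I (mpoly_ring n)"
  shows "I \<subseteq> carrier (mpoly_ring n)" "0 \<in> I"
    and "\<lbrakk>a \<in> I; b \<in> I\<rbrakk> \<Longrightarrow> a + b \<in> I"
    and "\<lbrakk>a \<in> I; b \<in> carrier (mpoly_ring n)\<rbrakk> \<Longrightarrow> a * b \<in> I"
proof -
  interpret ideal I "mpoly_ring n" by fact
  show "I \<subseteq> carrier (mpoly_ring n)" by (rule a_subset)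
  show "0 \<in> I" using additive_subgroup.zero_closed[OF is_additive_subgroup] by simp
  show "\<lbrakk>a \<in> I; b \<in> I\<rbrakk> \<Longrightarrow> a + b \<in> I" using additive_subgroup.a_closed[OF is_additive_subgroup, of a b] by simp
  show "\<lbrakk>a \<in> I; b \<in> carrier (mpoly_ring n)\<rbrakk> \<Longrightarrow> a * b \<in> I" using I_r_closed[of a b] by simp
qed

lemma mconst_carrier [simp]: "mconst c \<in> carrier (mpoly_ring n)"
  by (simp add: carrier_mpoly_iff mconst_def)

lemma mconst_0 [simp]: "mconst 0 = 0"
  by (simp add: mconst_def)

lemma mconst_1 [simp]: "mconst 1 = 1"
  by (simp add: mconst_def)

lemma mconst_add: "mconst (a + b) = mconst a + mconst b"
  by (simp add: mconst_def single_add)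

lemma mconst_uminus: "mconst (- a) = - mconst a"
  by (simp add: mconst_def single_uminus)

lemma mconst_mult: "mconst (a * b) = mconst a * mconst b"
  by (simp add: mconst_def mult_single)

text \<open>Inverses of nonzero constants are again constants. A ring homomorphism into a nonzero
  ring carries this subfield to a subfield, which is how \<open>subfield_scalars\<close> obtains the
  scalars of the quotient.\<close>

lemma subfield_range_mconst: "subfield (range mconst) (mpoly_ring n :: 'k::field mpoly ring)"
proof -
  let ?K = "range (mconst :: 'k \<Rightarrow> 'k mpoly)"
  interpret cring "mpoly_ring n :: 'k mpoly ring" by (rule mpoly_ring_cring)
  show ?thesis
  proof (rule subfieldI)
    have "subring ?K (mpoly_ring n)"
    proof (rule subringI)
      show "\<one>\<^bsub>mpoly_ring n\<^esub> \<in> ?K" by (metis mconst_1 mpoly_ring_sel(4) rangeI)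
    qed (auto simp: mpoly_ring_a_inv simp flip: mconst_add mconst_mult mconst_uminus)
    then show "subcring ?K (mpoly_ring n)" by (rule subcringI')
    have inverse: "mconst c * mconst (inverse c) = 1" if "c \<noteq> 0" for c :: 'k
      using that by (simp flip: mconst_mult)
    have unit: "mconst c \<in> Units (mpoly_ring n\<lparr>carrier := ?K\<rparr>)" if "c \<noteq> 0" for c
      using inverse[OF that] unfolding Units_def
      by (auto simp: mult.commute intro!: exI[of _ "inverse c"])
    have "?K - {0} \<subseteq> Units (mpoly_ring n\<lparr>carrier := ?K\<rparr>)"
      by (auto intro: unit)
    moreover have "Units (mpoly_ring n\<lparr>carrier := ?K\<rparr>) \<subseteq> ?K - {0}"
      by (auto simp: Units_def)
    ultimately show "Units (mpoly_ring n\<lparr>carrier := ?K\<rparr>) = ?K - {\<zero>\<^bsub>mpoly_ring n\<^esub>}"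
      by simp
  qed
qed

section \<open>Forms, degrees and monomials\<close>

lemma mvar_carrier: "j \<le> n \<Longrightarrow> mvar j \<in> carrier (mpoly_ring n)"
  by (simp add: carrier_mpoly_iff mvar_def)

lemma forms_carrier: "p \<in> forms n d \<Longrightarrow> p \<in> carrier (mpoly_ring n)"
  by (simp add: forms_def)

lemma forms_zero: "0 \<in> forms n d"
  by (simp add: forms_def carrier_mpoly_iff)

lemma forms_add: "\<lbrakk>p \<in> forms n d; q \<in> forms n d\<rbrakk> \<Longrightarrow> p + q \<in> forms n d"
  using Poly_Mapping.keys_add[of p q] unfolding forms_def carrier_mpoly_iff by blast

text \<open>Summing over a common finite set of variables, instead of the support of each monomial,
  makes degrees additive and lets them be bounded over \<open>{0..n}\<close>.\<close>

lemma monom_degree_superset: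
  assumes "finite A" "Poly_Mapping.keys t \<subseteq> A"
  shows "monom_degree t = (\<Sum>v\<in>A. Poly_Mapping.lookup t v)"
  unfolding monom_degree_def using assms
  by (intro sum.mono_neutral_left) (auto simp: in_keys_iff)

lemma monom_degree_add: "monom_degree (s + t) = monom_degree s + monom_degree t"
proof -
  let ?A = "Poly_Mapping.keys s \<union> Poly_Mapping.keys t"
  have "Poly_Mapping.keys (s + t) \<subseteq> ?A" by (rule Poly_Mapping.keys_add)
  then show ?thesis
    by (simp add: monom_degree_superset[of ?A] lookup_add sum.distrib)
qed

lemma monom_degree_0 [simp]: "monom_degree 0 = 0"
  by (simp add: monom_degree_def)

lemma forms_mult:
  assumes p: "p \<in> forms n d" and q: "q \<in> forms n e"
  shows "p * q \<in> forms n (d + e)"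
proof -
  have "monom_degree t = d + e" if t: "t \<in> Poly_Mapping.keys (p * q)" for t
  proof -
    obtain a b where "t = a + b" "a \<in> Poly_Mapping.keys p" "b \<in> Poly_Mapping.keys q"
      using t Poly_Mapping.keys_mult[of p q] by blast
    then show ?thesis using p q by (simp add: forms_def monom_degree_add)
  qed
  then show ?thesis
    using p q carrier_mpoly_mult[of p n q] by (simp add: forms_def)
qed

lemma forms_one: "1 \<in> forms n 0"
  by (simp add: forms_def carrier_mpoly_iff)

lemma forms_power: "p \<in> forms n d \<Longrightarrow> p ^ i \<in> forms n (i * d)"
  by (induction i) (auto simp: forms_one intro: forms_mult)

lemma forms_mconst: "mconst c \<in> forms n 0"
  by (simp add: forms_def carrier_mpoly_iff mconst_def)

lemma forms_mvar: "j \<le> n \<Longrightarrow> mvar j \<in> forms n 1"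
  by (simp add: forms_def carrier_mpoly_iff mvar_def monom_degree_def)

text \<open>Each exponent is at most the degree, so the exponent functions take values in
  \<open>{0..d}\<close> on \<open>{0..n}\<close> and vanish elsewhere; there are finitely many of
  these.\<close>

lemma finite_monomials:
  "finite {t. Poly_Mapping.keys t \<subseteq> {0..n} \<and> monom_degree t = d}" (is "finite ?T")
proof -
  have "Poly_Mapping.lookup ` ?T
      \<subseteq> {f. \<forall>v. (v \<in> {0..n} \<longrightarrow> f v \<in> {0..d}) \<and> (v \<notin> {0..n} \<longrightarrow> f v = 0)}"
  proof clarify
    fix t :: "nat \<Rightarrow>\<^sub>0 nat" and v assume t: "Poly_Mapping.keys t \<subseteq> {0..n}"
    have "Poly_Mapping.lookup t v \<le> monom_degree t"
      unfolding monom_degree_def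
      by (cases "v \<in> Poly_Mapping.keys t") (auto simp: in_keys_iff intro: member_le_sum)
    then show "(v \<in> {0..n} \<longrightarrow> Poly_Mapping.lookup t v \<in> {0..monom_degree t})
        \<and> (v \<notin> {0..n} \<longrightarrow> Poly_Mapping.lookup t v = 0)"
      using t by (auto simp: in_keys_iff)
  qed
  then have "finite (Poly_Mapping.lookup ` ?T)"
    by (rule finite_subset) (intro finite_set_of_finite_funs; simp)
  moreover have "inj_on Poly_Mapping.lookup ?T"
    by (meson inj_onI lookup_inject)
  ultimately show ?thesis by (rule finite_imageD)
qed

text \<open>\<open>T\<close> may exceed the support of \<open>p\<close>, so that one list of
  monomials can serve for all forms of a given degree.\<close>

lemma mpoly_as_sum_of_monomials:
  assumes "finite T" "Poly_Mapping.keys p \<subseteq> T"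
  shows "p = (\<Sum>t\<in>T. mconst (Poly_Mapping.lookup p t) * Poly_Mapping.single t 1)"
proof (rule poly_mapping_eqI)
  fix s
  have "Poly_Mapping.lookup (\<Sum>t\<in>T. mconst (Poly_Mapping.lookup p t) * Poly_Mapping.single t 1) s
      = (\<Sum>t\<in>T. if t = s then Poly_Mapping.lookup p t else 0)"
    unfolding lookup_sum
    by (intro sum.cong refl) (simp add: mconst_def mult_single lookup_single when_def)
  also have "\<dots> = Poly_Mapping.lookup p s"
    using assms by (auto simp: in_keys_iff)
  finally show "Poly_Mapping.lookup p s
      = Poly_Mapping.lookup (\<Sum>t\<in>T. mconst (Poly_Mapping.lookup p t) * Poly_Mapping.single t 1) s"
    by simp
qed


section \<open>Linear algebra in the graded quotients\<close>

text \<open>The counterpart of \<open>ring.combine\<close> on representatives. It truncates to the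
  shorter list in the same way, so \<open>combine_cls\<close> needs no condition on lengths.\<close>

definition lincomb :: "'k::field list \<Rightarrow> 'k mpoly list \<Rightarrow> 'k mpoly" where
  "lincomb cs fs = sum_list (map2 (\<lambda>c f. mconst c * f) cs fs)"

lemma lincomb_simps [simp]:
  "lincomb [] fs = 0" "lincomb cs [] = 0"
  "lincomb (c # cs) (f # fs) = mconst c * f + lincomb cs fs"
  by (simp_all add: lincomb_def)

lemma lincomb_replicate_0: "lincomb (replicate k 0) fs = 0"
proof (induction fs arbitrary: k)
  case (Cons f fs)
  then show ?case by (cases k) simp_all
qed simp

lemma lincomb_mult_right: "lincomb cs (map (\<lambda>f. f * g) fs) = lincomb cs fs * g"
proof (induction fs arbitrary: cs)
  case (Cons f fs)
  then show ?case by (cases cs) (simp_all add: algebra_simps)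
qed simp

lemma lincomb_forms: "set fs \<subseteq> forms n d \<Longrightarrow> lincomb cs fs \<in> forms n d"
proof (induction fs arbitrary: cs)
  case (Cons f fs)
  then show ?case
    using forms_mult[OF forms_mconst, of f n d]
    by (cases cs) (auto simp: forms_zero intro!: forms_add)
qed (simp add: forms_zero)

lemma lincomb_carrier:
  "set fs \<subseteq> carrier (mpoly_ring n) \<Longrightarrow> lincomb cs fs \<in> carrier (mpoly_ring n)"
proof (induction fs arbitrary: cs)
  case (Cons f fs)
  interpret cring "mpoly_ring n :: 'a mpoly ring" by (rule mpoly_ring_cring)
  have "mconst c * f + lincomb ds fs \<in> carrier (mpoly_ring n)" for c ds
    using Cons add.m_closed[of "mconst c * f" "lincomb ds fs"] carrier_mpoly_mult[of "mconst c" n f] by simp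
  then show ?case by (cases cs) (simp_all add: carrier_mpoly_iff)
qed (simp add: carrier_mpoly_iff)

text \<open>Linear independence of the classes, phrased with polynomials so that the same list can
  be tested modulo two different ideals. The lengths must agree because \<open>lincomb\<close>
  ignores surplus coefficients.\<close>

definition independent_mod :: "'k::field mpoly set \<Rightarrow> 'k mpoly list \<Rightarrow> bool" where
  "independent_mod I fs \<longleftrightarrow>
     (\<forall>cs. length cs = length fs \<longrightarrow> lincomb cs fs \<in> I \<longrightarrow> set cs \<subseteq> {0})"

locale mpoly_ideal = ideal I "mpoly_ring n"
  for n :: nat and I :: "'k::field mpoly set"
begin

sublocale Q: cring "quot n I"
  by (rule quotient_is_cring[OF mpoly_ring_cring])

lemma cls_ring_hom: "ring_hom_ring (mpoly_ring n) (quot n I) (cls n I)"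
  using rcos_ring_hom_ring unfolding cls_def .

sublocale H: ring_hom_ring "mpoly_ring n" "quot n I" "cls n I"
  by (rule cls_ring_hom)

lemma cls_add:
  "\<lbrakk>a \<in> carrier (mpoly_ring n); b \<in> carrier (mpoly_ring n)\<rbrakk> \<Longrightarrow>
    cls n I (a + b) = cls n I a \<oplus>\<^bsub>quot n I\<^esub> cls n I b"
  using H.hom_add[of a b] by simp

lemma cls_mult:
  "\<lbrakk>a \<in> carrier (mpoly_ring n); b \<in> carrier (mpoly_ring n)\<rbrakk> \<Longrightarrow>
    cls n I (a * b) = cls n I a \<otimes>\<^bsub>quot n I\<^esub> cls n I b"
  using H.hom_mult[of a b] by simp

lemma cls_0 [simp]: "cls n I 0 = \<zero>\<^bsub>quot n I\<^esub>"
  using H.hom_zero by simp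

lemma cls_eq_iff:
  assumes "a \<in> carrier (mpoly_ring n)" "b \<in> carrier (mpoly_ring n)"
  shows "cls n I a = cls n I b \<longleftrightarrow> a - b \<in> I"
  using quotient_eq_iff_same_a_r_cos[OF ideal_axioms assms] mpoly_ring_a_minus[OF assms(2)]
  unfolding cls_def by simp

lemma cls_eq_zero_iff:
  "a \<in> carrier (mpoly_ring n) \<Longrightarrow> cls n I a = \<zero>\<^bsub>quot n I\<^esub> \<longleftrightarrow> a \<in> I"
  using cls_eq_iff[of a 0] by (simp add: carrier_mpoly_iff)

lemma combine_cls:
  "set fs \<subseteq> carrier (mpoly_ring n) \<Longrightarrow>
    Q.combine (map (\<lambda>c. cls n I (mconst c)) cs) (map (cls n I) fs) = cls n I (lincomb cs fs)"
proof (induction fs arbitrary: cs)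
  case (Cons f fs)
  then show ?case
    by (cases cs)
      (simp_all add: cls_add cls_mult lincomb_carrier carrier_mpoly_mult)
qed simp

lemma lists_of_scalars:
  "set Ks \<subseteq> scalars n I \<longleftrightarrow> (\<exists>cs. Ks = map (\<lambda>c. cls n I (mconst c)) cs)"
proof -
  have "set Ks \<subseteq> scalars n I \<longleftrightarrow> Ks \<in> lists (scalars n I)" by auto
  then show ?thesis by (simp add: scalars_def lists_image image_iff)
qed

end

text \<open>Properness makes the quotient a nonzero ring. Then \<open>scalars n I\<close> is a
  subfield and the dimension theory of embedded algebras applies to the graded pieces.\<close>

locale proper_mpoly_ideal = mpoly_ideal +
  assumes proper: "I \<noteq> carrier (mpoly_ring n)"
begin

text \<open>A nonzero constant is a unit, so its membership would put \<open>1\<close> into the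
  proper ideal.\<close>

lemma mconst_in_ideal_iff: "mconst c \<in> I \<longleftrightarrow> c = 0"
proof
  assume "mconst c \<in> I"
  then have "mconst c * mconst (inverse c) \<in> I"
    by (intro ideal_mpoly_closed(4)[OF ideal_axioms]) simp_all
  then have "c \<noteq> 0 \<Longrightarrow> 1 \<in> I"
    by (simp flip: mconst_mult)
  then show "c = 0"
    using one_imp_carrier proper by auto
qed (simp add: ideal_mpoly_closed(2)[OF ideal_axioms])

lemma cls_mconst_eq_zero_iff: "cls n I (mconst c) = \<zero>\<^bsub>quot n I\<^esub> \<longleftrightarrow> c = 0"
  by (simp add: cls_eq_zero_iff mconst_in_ideal_iff)

lemma subfield_scalars: "subfield (scalars n I) (quot n I)"
proof -
  have "cls n I (mconst 1) \<noteq> \<zero>\<^bsub>quot n I\<^esub>"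
    by (simp only: cls_mconst_eq_zero_iff) simp
  then have "\<one>\<^bsub>quot n I\<^esub> \<noteq> \<zero>\<^bsub>quot n I\<^esub>"
    using H.hom_one by simp
  then have "subfield (cls n I ` range mconst) (quot n I)"
    by (rule H.img_is_subfield(2)[OF subfield_range_mconst])
  then show ?thesis by (simp add: scalars_def image_image)
qed

lemma independent_cls_iff:
  assumes "set fs \<subseteq> carrier (mpoly_ring n)"
  shows "Q.independent (scalars n I) (map (cls n I) fs) \<longleftrightarrow> independent_mod I fs"
proof
  assume indep: "Q.independent (scalars n I) (map (cls n I) fs)"
  show "independent_mod I fs"
    unfolding independent_mod_def
  proof (intro allI impI)
    fix cs assume cs: "length cs = length fs" "lincomb cs fs \<in> I"
    let ?Ks = "map (\<lambda>c. cls n I (mconst c)) cs"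
    have "Q.combine ?Ks (map (cls n I) fs) = \<zero>\<^bsub>quot n I\<^esub>"
      using cs assms by (simp add: combine_cls cls_eq_zero_iff lincomb_carrier)
    moreover have "set ?Ks \<subseteq> scalars n I" using lists_of_scalars by blast
    ultimately have "set (take (length (map (cls n I) fs)) ?Ks) \<subseteq> {\<zero>\<^bsub>quot n I\<^esub>}"
      using Q.independent_imp_trivial_combine[OF subfield_scalars indep] by blast
    then show "set cs \<subseteq> {0}"
      using cs by (auto simp: cls_mconst_eq_zero_iff)
  qed
next
  assume indep: "independent_mod I fs"
  show "Q.independent (scalars n I) (map (cls n I) fs)"
  proof (rule Q.trivial_combine_imp_independent[OF subfield_scalars])
    show "set (map (cls n I) fs) \<subseteq> carrier (quot n I)" using assms by auto
    fix Ks assume Ks: "set Ks \<subseteq> scalars n I" "Q.combine Ks (map (cls n I) fs) = \<zero>\<^bsub>quot n I\<^esub>"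
    then obtain cs where cs: "Ks = map (\<lambda>c. cls n I (mconst c)) cs"
      using lists_of_scalars by blast
    \<comment> \<open>The criterion for independence admits coefficient lists of any length, whereas
      \<open>independent_mod\<close> wants length \<open>length fs\<close>. Cutting and padding with
      zeros leaves the linear combination unchanged.\<close>
    let ?ds = "take (length fs) cs @ replicate (length fs - length cs) 0"
    have "lincomb ?ds fs = lincomb cs fs"
    proof (induction fs arbitrary: cs)
      case (Cons f fs)
      show ?case
        using Cons.IH[of "tl cs"] by (cases cs) (simp_all add: lincomb_replicate_0)
    qed simp
    also have "\<dots> \<in> I"
      using Ks cs assms by (simp add: combine_cls cls_eq_zero_iff lincomb_carrier)
    finally have "set ?ds \<subseteq> {0}"
      by (intro indep[unfolded independent_mod_def, rule_format]) simp_all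
    then have "set (take (length fs) cs) \<subseteq> {0}" by simp
    then show "set (take (length (map (cls n I) fs)) Ks) \<subseteq> {\<zero>\<^bsub>quot n I\<^esub>}"
      unfolding cs by (auto simp: take_map)
  qed
qed

lemma Span_cls:
  assumes "set fs \<subseteq> carrier (mpoly_ring n)"
  shows "Q.Span (scalars n I) (map (cls n I) fs)
    = {cls n I (lincomb cs fs) | cs. length cs = length fs}" (is "?L = ?R")
proof -
  have "set (map (cls n I) fs) \<subseteq> carrier (quot n I)" using assms by auto
  note eq = Q.Span_eq_combine_set_length_version[OF subfield_scalars this]
  show ?thesis
    unfolding eq lists_of_scalars using assms
    by (auto simp: combine_cls) (metis assms combine_cls length_map)
qed

text \<open>The monomials of degree \<open>d\<close> serve. This makes every graded piece
  finite-dimensional.\<close>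

lemma ex_spanning_forms:
  "\<exists>fs. set fs \<subseteq> forms n d \<and> Q.Span (scalars n I) (map (cls n I) fs) = piece n I d"
proof -
  let ?T = "{t. Poly_Mapping.keys t \<subseteq> {0..n} \<and> monom_degree t = d}"
  obtain ts where ts: "set ts = ?T" "distinct ts"
    using finite_distinct_list[OF finite_monomials] by blast
  let ?fs = "map (\<lambda>t. Poly_Mapping.single t (1::'a)) ts"
  have fs: "set ?fs \<subseteq> forms n d"
    by (auto simp: ts forms_def carrier_mpoly_iff)
  have "piece n I d \<subseteq> Q.Span (scalars n I) (map (cls n I) ?fs)"
  proof
    fix x assume "x \<in> piece n I d"
    then obtain p where p: "p \<in> forms n d" "x = cls n I p" by (auto simp: piece_def)
    have "Poly_Mapping.keys p \<subseteq> ?T"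
      using p(1) by (auto simp: forms_def carrier_mpoly_iff)
    then have "p = (\<Sum>t\<in>set ts. mconst (Poly_Mapping.lookup p t) * Poly_Mapping.single t 1)"
      unfolding ts by (rule mpoly_as_sum_of_monomials[OF finite_monomials])
    also have "\<dots> = (\<Sum>t\<leftarrow>ts. mconst (Poly_Mapping.lookup p t) * Poly_Mapping.single t 1)"
      using ts(2) by (rule sum_list_distinct_conv_sum_set[symmetric])
    also have "\<dots> = lincomb (map (Poly_Mapping.lookup p) ts) ?fs"
      unfolding lincomb_def by (induction ts) simp_all
    finally have "x = cls n I (lincomb (map (Poly_Mapping.lookup p) ts) ?fs)"
      using p(2) by simp
    moreover have fsc: "set ?fs \<subseteq> carrier (mpoly_ring n)" using fs forms_carrier by blast
    ultimately show "x \<in> Q.Span (scalars n I) (map (cls n I) ?fs)"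
      unfolding Span_cls[OF fsc] by (metis (mono_tags, lifting) length_map mem_Collect_eq)
  qed
  moreover have "Q.Span (scalars n I) (map (cls n I) ?fs) \<subseteq> piece n I d"
    using fs forms_carrier lincomb_forms[OF fs] unfolding piece_def
    by (subst Span_cls) blast+
  ultimately show ?thesis using fs by blast
qed

text \<open>\<open>hilbert\<close> rests on a definite description, which is meaningful only once a
  dimension is known to exist; the finite spanning family supplies it.\<close>

lemma dimension_piece: "Q.dimension (hilbert n I d) (scalars n I) (piece n I d)"
proof -
  obtain fs where fs: "set fs \<subseteq> forms n d" "Q.Span (scalars n I) (map (cls n I) fs) = piece n I d"
    using ex_spanning_forms by blast
  have "set fs \<subseteq> carrier (mpoly_ring n)"
    using fs(1) forms_carrier by blast
  then have "set (map (cls n I) fs) \<subseteq> carrier (quot n I)" by auto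
  then have "Q.finite_dimension (scalars n I) (piece n I d)"
    using Q.Span_finite_dimension[OF subfield_scalars] fs(2) by metis
  from Q.finite_dimensionE[OF subfield_scalars this] show ?thesis
    by (simp add: hilbert_def over_def)
qed

text \<open>The vectors of a basis lie in the piece they span, so each of them is the class of a
  form and can be lifted.\<close>

lemma ex_basis_forms:
  "\<exists>fs. set fs \<subseteq> forms n d \<and> is_basis n I (map (cls n I) fs) (piece n I d)"
proof -
  obtain Vs where Vs: "set Vs \<subseteq> carrier (quot n I)" "Q.independent (scalars n I) Vs"
      "Q.Span (scalars n I) Vs = piece n I d"
    using Q.exists_base[OF subfield_scalars dimension_piece] by blast
  have "set Vs \<subseteq> cls n I ` forms n d"
    using Q.Span_base_incl[OF subfield_scalars Vs(1)] Vs(3) by (simp add: piece_def)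
  then have "Vs \<in> map (cls n I) ` lists (forms n d)"
    unfolding lists_image[symmetric] by auto
  then obtain fs where "set fs \<subseteq> forms n d" "Vs = map (cls n I) fs"
    by (auto simp: subset_iff)
  then show ?thesis using Vs unfolding is_basis_def by blast
qed

text \<open>An independent family with as many members as the dimension spans. Later proofs thus
  check independence and count, never spanning.\<close>

lemma is_basis_iff:
  assumes fs: "set fs \<subseteq> forms n d"
  shows "is_basis n I (map (cls n I) fs) (piece n I d)
    \<longleftrightarrow> independent_mod I fs \<and> length fs = hilbert n I d"
proof -
  have piece: "set (map (cls n I) fs) \<subseteq> piece n I d" using fs by (auto simp: piece_def)
  have fsc: "set fs \<subseteq> carrier (mpoly_ring n)" using fs forms_carrier by blast
  show ?thesis
    unfolding is_basis_def independent_cls_iff[OF fsc]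
    using Q.independent_length_eq_dimension[OF subfield_scalars dimension_piece _ piece]
    by (auto simp: independent_cls_iff[OF fsc])
qed

lemma independent_mod_length_le:
  assumes fs: "set fs \<subseteq> forms n d" and indep: "independent_mod I fs"
  shows "length fs \<le> hilbert n I d"
proof -
  have piece: "set (map (cls n I) fs) \<subseteq> piece n I d" using fs by (auto simp: piece_def)
  have fsc: "set fs \<subseteq> carrier (mpoly_ring n)" using fs forms_carrier by blast
  show ?thesis
    using Q.independent_length_le_dimension[OF subfield_scalars dimension_piece _ piece] indep
    by (simp add: independent_cls_iff[OF fsc])
qed

lemma forms_eq_lincomb_mod:
  assumes fs: "set fs \<subseteq> forms n d" and basis: "is_basis n I (map (cls n I) fs) (piece n I d)"
    and f: "f \<in> forms n d"
  shows "\<exists>cs. length cs = length fs \<and> f - lincomb cs fs \<in> I"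
proof -
  have fsc: "set fs \<subseteq> carrier (mpoly_ring n)" using fs forms_carrier by blast
  have "cls n I f \<in> Q.Span (scalars n I) (map (cls n I) fs)"
    using basis f by (auto simp: is_basis_def piece_def)
  then show ?thesis
    using Span_cls[OF fsc] cls_eq_iff forms_carrier[OF f] lincomb_carrier[OF fsc] by auto
qed

text \<open>Used to show that the upper part is proper.\<close>

lemma forms_not_subset:
  assumes "hilbert n I d > 0"
  shows "\<not> forms n d \<subseteq> I"
proof
  assume sub: "forms n d \<subseteq> I"
  obtain fs where fs: "set fs \<subseteq> forms n d" "is_basis n I (map (cls n I) fs) (piece n I d)"
    using ex_basis_forms by blast
  \<comment> \<open>With all coefficients \<open>1\<close> this is a nontrivial relation unless the
    basis is empty, which the positive dimension excludes.\<close>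
  have "lincomb (replicate (length fs) 1) fs \<in> I"
    using lincomb_forms[OF fs(1)] sub by blast
  then have "set (replicate (length fs) (1::'a)) \<subseteq> {0}"
    using fs is_basis_iff unfolding independent_mod_def by (meson length_replicate)
  then show False
    using fs is_basis_iff assms by (auto simp: set_replicate_conv_if split: if_splits)
qed

end

section \<open>Comparison of Hilbert functions\<close>

text \<open>No vector of the zero ring lies outside \<open>{\<zero>}\<close>, so a derivation of
  \<open>dimension\<close> never passes its zero case. The argument is direct because the scalars of
  the zero ring do not form a subfield.\<close>

lemma (in ring) dim_trivial:
  assumes "carrier R = {\<zero>}"
  shows "dim K {\<zero>} = 0"
proof -
  have "m = 0 \<and> E = {\<zero>}" if "dimension m K E" for m E
    using that assms by (induction rule: dimension.induct) auto
  then show ?thesis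
    unfolding dim_def by (intro the_equality) auto
qed

text \<open>This forces an ideal of projective dimension zero to be proper, its Hilbert function
  being eventually positive.\<close>

lemma hilbert_carrier: "hilbert n (carrier (mpoly_ring n)) d = 0"
proof -
  let ?C = "carrier (mpoly_ring n :: 'a mpoly ring)"
  interpret cring "mpoly_ring n :: 'a mpoly ring" by (rule mpoly_ring_cring)
  interpret mpoly_ideal n ?C
    by (rule mpoly_ideal.intro) (rule oneideal)
  have z: "cls n ?C a = \<zero>\<^bsub>quot n ?C\<^esub>" if "a \<in> ?C" for a
    using that by (simp add: cls_eq_zero_iff)
  have "piece n ?C d = (\<lambda>_. \<zero>\<^bsub>quot n ?C\<^esub>) ` (forms n d :: 'a mpoly set)"
    unfolding piece_def by (intro image_cong refl z forms_carrier)
  also have "\<dots> = {\<zero>\<^bsub>quot n ?C\<^esub>}"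
    using forms_zero[of n d, where 'a = 'a] by (auto simp: image_constant_conv)
  finally have "piece n ?C d = {\<zero>\<^bsub>quot n ?C\<^esub>}" .
  moreover have "carrier (quot n ?C) = {\<zero>\<^bsub>quot n ?C\<^esub>}"
  proof -
    have "carrier (quot n ?C) = cls n ?C ` ?C"
      by (auto simp: FactRing_def A_RCOSETS_def' cls_def)
    then show ?thesis using z by auto
  qed
  ultimately show ?thesis
    unfolding hilbert_def using Q.dim_trivial by simp
qed

text \<open>A basis modulo \<open>J\<close> in degree \<open>d\<close> stays independent modulo
  \<open>I\<close>. Inclusion is required in degree \<open>d\<close> only, so that for large
  \<open>d\<close> the lemma applies to an ideal and its upper part in both directions.\<close>

lemma hilbert_antimono:
  assumes "proper_mpoly_ideal n I" "proper_mpoly_ideal n J" "I \<inter> forms n d \<subseteq> J"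
  shows "hilbert n J d \<le> hilbert n I d"
proof -
  interpret I: proper_mpoly_ideal n I by fact
  interpret J: proper_mpoly_ideal n J by fact
  obtain fs where fs: "set fs \<subseteq> forms n d" "is_basis n J (map (cls n J) fs) (piece n J d)"
    using J.ex_basis_forms by blast
  have "independent_mod I fs"
    using fs assms(3) lincomb_forms[OF fs(1)] J.is_basis_iff[OF fs(1)]
    unfolding independent_mod_def by blast
  then show ?thesis
    using I.independent_mod_length_le fs J.is_basis_iff by metis
qed

text \<open>A basis modulo \<open>J\<close> remains independent modulo \<open>I\<close>, hence is a basis modulo \<open>I\<close> when the
  dimensions agree; expanding an element of \<open>J\<close> in it leaves only its part in \<open>I\<close>.\<close>

lemma hilbert_eq_imp_same_forms:
  assumes "proper_mpoly_ideal n I" "proper_mpoly_ideal n J" "I \<subseteq> J"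
    and "hilbert n I d = hilbert n J d"
  shows "J \<inter> forms n d = I \<inter> forms n d"
proof -
  interpret I: proper_mpoly_ideal n I by fact
  interpret J: proper_mpoly_ideal n J by fact
  obtain fs where fs: "set fs \<subseteq> forms n d" "is_basis n J (map (cls n J) fs) (piece n J d)"
    using J.ex_basis_forms by blast
  then have indJ: "independent_mod J fs" and len: "length fs = hilbert n J d"
    using J.is_basis_iff by blast+
  have "independent_mod I fs"
    using indJ assms(3) unfolding independent_mod_def by blast
  then have basis: "is_basis n I (map (cls n I) fs) (piece n I d)"
    using I.is_basis_iff[OF fs(1)] assms(4) len by simp
  have "f \<in> I" if f: "f \<in> J" "f \<in> forms n d" for f
  proof -
    obtain cs where cs: "length cs = length fs" "f - lincomb cs fs \<in> I"
      using I.forms_eq_lincomb_mod[OF fs(1) basis f(2)] by blast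
    \<comment> \<open>This element is \<open>lincomb cs fs\<close>, written with a sum and a product
      to match the closure rules.\<close>
    have "f + (f - lincomb cs fs) * (- 1) \<in> J"
      using f(1) cs(2) assms(3)
      by (intro ideal_mpoly_closed[OF J.ideal_axioms]) (auto simp: carrier_mpoly_iff)
    then have "set cs \<subseteq> {0}"
      using indJ cs(1) unfolding independent_mod_def by simp
    then have "lincomb cs fs = 0"
      by (metis lincomb_replicate_0 replicate_eqI singletonD subset_iff)
    then show ?thesis using cs(2) by simp
  qed
  then show ?thesis using assms(3) by blast
qed


section \<open>The upper part of an ideal\<close>

lemma ideal_upper_part:
  assumes "\<forall>Q\<in>\<Q>. primary_ideal Q (mpoly_ring n)"
  shows "ideal (upper_part n \<Q>) (mpoly_ring n)"
proof -
  let ?\<P> = "{Q \<in> \<Q>. radical (mpoly_ring n) Q \<noteq> irrelevant_ideal n}"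
  interpret cring "mpoly_ring n :: 'a mpoly ring" by (rule mpoly_ring_cring)
  \<comment> \<open>Inserting the carrier keeps the family nonempty, as \<open>i_Intersect\<close>
    demands, even if no component survives.\<close>
  have "\<Inter> (insert (carrier (mpoly_ring n)) ?\<P>) = upper_part n \<Q>"
    by (simp add: upper_part_def ideal_Inter_def)
  moreover have "ideal (\<Inter> (insert (carrier (mpoly_ring n)) ?\<P>)) (mpoly_ring n)"
    using assms by (intro i_Intersect) (auto simp: primary_ideal_def oneideal)
  ultimately show ?thesis by simp
qed

lemma mvar_power: "mvar j ^ k = Poly_Mapping.single (Poly_Mapping.single j k) 1"
proof (induction k)
  case (Suc k)
  have "Poly_Mapping.single (Poly_Mapping.single j (Suc k)) 1
      = mvar j * Poly_Mapping.single (Poly_Mapping.single j k) (1::'a)"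
    unfolding mvar_def mult_single single_add[symmetric] by simp
  then show ?case using Suc by simp
qed simp

text \<open>Pigeonhole: if each \<open>x\<^sub>j\<close> has a power in \<open>Q\<close>, then a monomial of large degree has some
  exponent large enough to be divisible by one of these powers.\<close>

lemma forms_subset_of_radical:
  assumes Q: "ideal Q (mpoly_ring n)" and rad: "radical (mpoly_ring n) Q = irrelevant_ideal n"
  shows "\<exists>N. \<forall>d\<ge>N. forms n d \<subseteq> Q"
proof -
  interpret ideal Q "mpoly_ring n" by fact
  note Q_closed = ideal_mpoly_closed[OF Q]
  have "\<exists>k. mvar j ^ k \<in> Q" if "j \<le> n" for j
  proof -
    have "(mvar j :: 'a mpoly) \<in> irrelevant_ideal n"
      unfolding irrelevant_ideal_def
      by (rule subsetD[OF genideal_self]) (use that in \<open>auto simp: mvar_carrier\<close>)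
    then show ?thesis using rad by (auto simp: radical_def)
  qed
  then obtain k where k: "\<And>j. j \<le> n \<Longrightarrow> mvar j ^ k j \<in> Q" by metis
  \<comment> \<open>The sum is a common upper bound of the exponents \<open>k j\<close>.\<close>
  define K where "K = (\<Sum>j\<in>{0..n}. k j)"
  \<comment> \<open>If all \<open>n + 1\<close> exponents were below \<open>K\<close>, the degree
    would be at most \<open>Suc n * K\<close>; the summand \<open>1\<close> makes this a
    contradiction even when \<open>K\<close> is zero.\<close>
  have "forms n d \<subseteq> Q" if d: "d \<ge> Suc n * K + 1" for d
  proof
    fix p :: "'a mpoly" assume p: "p \<in> forms n d"
    have monomial: "mconst c * Poly_Mapping.single t 1 \<in> Q" if t: "t \<in> Poly_Mapping.keys p" for c t
    proof -
      have tk: "Poly_Mapping.keys t \<subseteq> {0..n}" and deg: "monom_degree t = d"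
        using p t by (auto simp: forms_def carrier_mpoly_iff)
      have "\<exists>j\<in>{0..n}. K \<le> Poly_Mapping.lookup t j"
      proof (rule ccontr)
        assume "\<not> ?thesis"
        then have "(\<Sum>v\<in>{0..n}. Poly_Mapping.lookup t v) \<le> (\<Sum>v\<in>{0..n}. K)"
          by (intro sum_mono) (meson le_cases)
        then show False
          using monom_degree_superset[OF _ tk] deg d by simp
      qed
      then obtain j where j: "j \<le> n" "K \<le> Poly_Mapping.lookup t j" by auto
      have "k j \<le> K" unfolding K_def using j by (intro member_le_sum) auto
      with j have kj: "k j \<le> Poly_Mapping.lookup t j" by simp
      define s where "s = t - Poly_Mapping.single j (k j)"
      have ts: "t = Poly_Mapping.single j (k j) + s"
        using kj unfolding s_def
        by (intro poly_mapping_eqI) (auto simp: lookup_add lookup_minus lookup_single when_def)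
      have "Poly_Mapping.keys s \<subseteq> {0..n}"
        using tk unfolding s_def by (auto simp: in_keys_iff lookup_minus subset_iff)
      then have s: "Poly_Mapping.single s c \<in> carrier (mpoly_ring n)"
        by (simp add: carrier_mpoly_iff)
      have "mconst c * Poly_Mapping.single t 1 = mvar j ^ k j * Poly_Mapping.single s c"
        unfolding ts by (simp add: mconst_def mult_single mvar_power)
      also have "\<dots> \<in> Q" using k[OF j(1)] s by (rule Q_closed)
      finally show ?thesis .
    qed
    have sum_in: "(\<Sum>t\<in>T. mconst (Poly_Mapping.lookup p t) * Poly_Mapping.single t 1) \<in> Q"
      if "finite T" "T \<subseteq> Poly_Mapping.keys p" for T
      using that by (induction T rule: finite_induct) (auto intro: Q_closed monomial)
    show "p \<in> Q"
      by (subst mpoly_as_sum_of_monomials[of "Poly_Mapping.keys p"]) (simp_all add: sum_in)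
  qed
  then show ?thesis by blast
qed

text \<open>A component left out of \<open>upper_part\<close> has the irrelevant ideal as radical
  and so contains all forms of large degree; there the other components alone decide membership in
  \<open>I\<close>.\<close>

lemma upper_part_eventually_eq:
  assumes "minimal_primary_decomposition (mpoly_ring n) I \<Q>"
  shows "\<exists>N. \<forall>d\<ge>N. upper_part n \<Q> \<inter> forms n d \<subseteq> I"
proof -
  have fin: "finite \<Q>" and prim: "\<forall>Q\<in>\<Q>. primary_ideal Q (mpoly_ring n)"
    and I: "I = ideal_Inter (mpoly_ring n) \<Q>"
    using assms by (auto simp: minimal_primary_decomposition_def)
  have "\<forall>Q. \<exists>N. Q \<in> \<Q> \<and> radical (mpoly_ring n) Q = irrelevant_ideal n
      \<longrightarrow> (\<forall>d\<ge>N. forms n d \<subseteq> Q)"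
    using forms_subset_of_radical prim by (metis primary_ideal_def)
  then obtain N where N: "\<And>Q d. \<lbrakk>Q \<in> \<Q>; radical (mpoly_ring n) Q = irrelevant_ideal n; N Q \<le> d\<rbrakk>
      \<Longrightarrow> forms n d \<subseteq> Q"
    by metis
  \<comment> \<open>The sum dominates every single bound \<open>N Q\<close>.\<close>
  have "upper_part n \<Q> \<inter> forms n d \<subseteq> I" if d: "d \<ge> (\<Sum>Q\<in>\<Q>. N Q)" for d
  proof
    fix f assume f: "f \<in> upper_part n \<Q> \<inter> forms n d"
    have "f \<in> Q" if Q: "Q \<in> \<Q>" for Q
    proof (cases "radical (mpoly_ring n) Q = irrelevant_ideal n")
      case True
      have "N Q \<le> (\<Sum>Q\<in>\<Q>. N Q)" using Q fin by (intro member_le_sum) auto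
      then show ?thesis using subsetD[OF N[OF Q True], of d f] d f by simp
    next
      case False
      then show ?thesis using f Q by (auto simp: upper_part_def ideal_Inter_def)
    qed
    then show "f \<in> I" using f forms_carrier by (auto simp: I ideal_Inter_def)
  qed
  then show ?thesis by blast
qed

section \<open>Agreement of the ideal and its upper part from \<open>nz\<close> on\<close>

text \<open>Eventual constancy makes the set behind \<open>LEAST\<close> nonempty, so
  \<open>post\<close> itself is a stable index. Degrees \<open>d\<close> and \<open>max d N\<close>
  then have the same value.\<close>

lemma hilbert_post:
  assumes "\<And>i. i \<ge> N \<Longrightarrow> hilbert n I i = m" and "d \<ge> post n I"
  shows "hilbert n I d = m"
proof -
  have "\<forall>j\<ge>N. hilbert n I j = hilbert n I N" using assms(1) by simp
  then have "\<forall>j\<ge>post n I. hilbert n I j = hilbert n I (post n I)"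
    unfolding post_def by (rule LeastI)
  then have "hilbert n I d = hilbert n I (max d N)"
    using assms(2) by (metis max.coboundedI1)
  then show ?thesis using assms(1) by simp
qed

text \<open>Equality of forms is first known only in large degrees. It yields a common eventual
  Hilbert value, \<open>post\<close> carries that value down to \<open>nz\<close>, and equal
  dimensions with \<open>I\<close> inside the upper part give equality of forms there.\<close>

lemma upper_part_eq_from_nz:
  assumes "projective_dim_zero n I" and "minimal_primary_decomposition (mpoly_ring n) I \<Q>"
  shows "proper_mpoly_ideal n I" "proper_mpoly_ideal n (upper_part n \<Q>)"
    and "\<exists>m. \<forall>d\<ge>nz n I \<Q>. hilbert n I d = m \<and> upper_part n \<Q> \<inter> forms n d = I \<inter> forms n d"
proof -
  let ?J = "upper_part n \<Q>"
  obtain m N where m: "m > 0" and N: "\<And>i. i \<ge> N \<Longrightarrow> hilbert n I i = m" and idI: "ideal I (mpoly_ring n)"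
    using assms(1) by (auto simp: projective_dim_zero_def)
  show pI: "proper_mpoly_ideal n I"
  proof (intro proper_mpoly_ideal.intro mpoly_ideal.intro proper_mpoly_ideal_axioms.intro idI notI)
    assume "I = carrier (mpoly_ring n)"
    then show False using N[of N] m by (simp add: hilbert_carrier)
  qed
  obtain M where M: "\<And>d. d \<ge> M \<Longrightarrow> ?J \<inter> forms n d \<subseteq> I"
    using upper_part_eventually_eq[OF assms(2)] by blast
  have IJ: "I \<subseteq> ?J"
    using assms(2) by (auto simp: minimal_primary_decomposition_def upper_part_def ideal_Inter_def)
  show pJ: "proper_mpoly_ideal n ?J"
  proof (intro proper_mpoly_ideal.intro mpoly_ideal.intro proper_mpoly_ideal_axioms.intro notI)
    show "ideal ?J (mpoly_ring n)"
      using assms(2) by (intro ideal_upper_part) (simp add: minimal_primary_decomposition_def)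
    assume "?J = carrier (mpoly_ring n)"
    \<comment> \<open>Otherwise \<open>I\<close> would contain all forms of a degree in which its
      Hilbert function is \<open>m > 0\<close>.\<close>
    then have "forms n (max M N) \<subseteq> I"
      using M[of "max M N"] by (auto dest: forms_carrier)
    then show False
      using proper_mpoly_ideal.forms_not_subset[OF pI] N[of "max M N"] m by simp
  qed
  have hJ: "hilbert n ?J i = m" if "i \<ge> max M N" for i
    using hilbert_antimono[OF pI pJ, of i] hilbert_antimono[OF pJ pI, of i] IJ M[of i] N[of i] that
    by fastforce
  have "hilbert n I d = m" "hilbert n ?J d = m" if "d \<ge> nz n I \<Q>" for d
    using that by (auto simp: nz_def intro: hilbert_post[OF N] hilbert_post[OF hJ])
  then show "\<exists>m. \<forall>d\<ge>nz n I \<Q>. hilbert n I d = m \<and> ?J \<inter> forms n d = I \<inter> forms n d"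
    using hilbert_eq_imp_same_forms[OF pI pJ IJ] by metis
qed

section \<open>Cancellation of powers of \<open>l\<close> and the multiplication matrices\<close>

text \<open>The induction hypothesis for \<open>f * l\<close> strips \<open>i\<close> factors, and
  the non-zero divisor property removes the last one. It will be applied to the upper part, modulo
  which \<open>l\<close> is assumed to be a non-zero divisor.\<close>

lemma (in mpoly_ideal) non_zero_divisor_power_cancel:
  assumes nzd: "non_zero_divisor (quot n I) (cls n I l)" and l: "l \<in> carrier (mpoly_ring n)"
    and f: "f \<in> carrier (mpoly_ring n)" "f * l ^ i \<in> I"
  shows "f \<in> I"
  using f
proof (induction i arbitrary: f)
  case (Suc i)
  have "f * l \<in> I"
    using Suc.IH[of "f * l"] Suc.prems l by (simp add: carrier_mpoly_mult mult.assoc)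
  then have "cls n I l \<otimes>\<^bsub>quot n I\<^esub> cls n I f = \<zero>\<^bsub>quot n I\<^esub>"
    using l Suc.prems by (simp add: cls_eq_zero_iff mult.commute carrier_mpoly_mult flip: cls_mult)
  then have "cls n I f = \<zero>\<^bsub>quot n I\<^esub>"
    using nzd Suc.prems unfolding non_zero_divisor_def by simp
  then show ?case using Suc.prems by (simp add: cls_eq_zero_iff)
qed simp

theorem theorem3p4:
  fixes n :: nat
    and I :: "'k::field mpoly set"
    and \<Q> :: "'k mpoly set set"
    and es :: "'k mpoly list"
    and l :: "'k mpoly"
  assumes "projective_dim_zero n I"
    and "minimal_primary_decomposition (mpoly_ring n) I \<Q>"
    and "set es \<subseteq> forms n (nz n I \<Q>)"
    and "is_basis n I (map (cls n I) es) (piece n I (nz n I \<Q>))"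
    and "l \<in> forms n 1"
    and "non_zero_divisor (quot n (upper_part n \<Q>)) (cls n (upper_part n \<Q>) l)"
  shows "(\<forall>i>0. is_basis n I (shifted_basis n I es l i) (piece n I (nz n I \<Q> + i))) \<and>
    (\<forall>j\<in>{0..n}. \<exists>A. \<forall>i.
       represents n I A (mult_var n I j) (shifted_basis n I es l i) (shifted_basis n I es l (i + 1)))"
proof -
  let ?J = "upper_part n \<Q>" and ?z = "nz n I \<Q>"
  interpret I: proper_mpoly_ideal n I
    using upper_part_eq_from_nz(1)[OF assms(1,2)] .
  interpret J: proper_mpoly_ideal n ?J
    using upper_part_eq_from_nz(2)[OF assms(1,2)] .
  obtain m where m: "\<And>d. d \<ge> ?z \<Longrightarrow> hilbert n I d = m"
      "\<And>d. d \<ge> ?z \<Longrightarrow> ?J \<inter> forms n d = I \<inter> forms n d"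
    using upper_part_eq_from_nz(3)[OF assms(1,2)] by blast
  have lc: "l \<in> carrier (mpoly_ring n)" using assms(5) by (rule forms_carrier)
  have lp: "l ^ i \<in> forms n i" for i using forms_power[OF assms(5), of i] by simp
  define fs where "fs i = map (\<lambda>e. e * l ^ i) es" for i
  have shifted: "shifted_basis n I es l i = map (cls n I) (fs i)" for i
    by (simp add: shifted_basis_def fs_def)
  have fs: "set (fs i) \<subseteq> forms n (?z + i)" for i
    using assms(3) forms_mult[OF _ lp] by (auto simp: fs_def)
  have fsc: "set (fs i) \<subseteq> carrier (mpoly_ring n)" for i
    using fs forms_carrier by blast
  have es_ind: "independent_mod I es" and len: "length es = m"
    using I.is_basis_iff[OF assms(3)] assms(4) m(1) by auto
  have basis: "is_basis n I (shifted_basis n I es l i) (piece n I (?z + i))" for i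
  proof -
    \<comment> \<open>The relation passes from \<open>I\<close> to \<open>?J\<close> in degree
      \<open>?z + i\<close>, loses the factor \<open>l ^ i\<close> there, and returns to
      \<open>I\<close> in degree \<open>?z\<close>; both transfers use \<open>m(2)\<close>.\<close>
    have "set cs \<subseteq> {0}" if cs: "length cs = length es" "lincomb cs (fs i) \<in> I" for cs
    proof -
      have form: "lincomb cs es \<in> forms n ?z" using assms(3) by (rule lincomb_forms)
      have "lincomb cs (fs i) \<in> ?J"
        using m(2)[of "?z + i"] lincomb_forms[OF fs] cs(2) by auto
      then have "lincomb cs es \<in> ?J"
        using J.non_zero_divisor_power_cancel[OF assms(6) lc forms_carrier[OF form]]
        by (simp add: fs_def lincomb_mult_right)
      then have "lincomb cs es \<in> I" using m(2)[of ?z] form by auto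
      then show ?thesis using es_ind cs(1) unfolding independent_mod_def by blast
    qed
    then have "independent_mod I (fs i)"
      by (auto simp: independent_mod_def fs_def)
    then show ?thesis
      unfolding shifted I.is_basis_iff[OF fs] using len m(1) by (simp add: fs_def)
  qed
  \<comment> \<open>\<open>A\<close> is chosen before \<open>i\<close>. A matrix with respect to
    given bases is unique, so one matrix serving all \<open>i\<close> is the claimed
    independence.\<close>
  have "\<exists>A. \<forall>i. represents n I A (mult_var n I j) (shifted_basis n I es l i)
      (shifted_basis n I es l (i + 1))" if j: "j \<in> {0..n}" for j
  proof -
    have jc: "mvar j \<in> carrier (mpoly_ring n)" using j by (simp add: mvar_carrier)
    \<comment> \<open>These are the coordinates for \<open>i = 0\<close>: the product has degree
      \<open>?z + 1\<close>, where \<open>fs 1\<close> is already known to give a basis.\<close>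
    have "\<exists>cs. length cs = m \<and> mvar j * es ! r - lincomb cs (fs 1) \<in> I" if r: "r < m" for r
    proof -
      have "es ! r \<in> forms n ?z" using r len assms(3) by auto
      then have "mvar j * es ! r \<in> forms n (?z + 1)"
        using forms_mult[OF forms_mvar, of j n] j by fastforce
      then show ?thesis
        using I.forms_eq_lincomb_mod[OF fs[of 1] basis[of 1, unfolded shifted]] len
        by (metis fs_def length_map)
    qed
    then obtain c where c: "\<And>r. r < m \<Longrightarrow> length (c r) = m"
        "\<And>r. r < m \<Longrightarrow> mvar j * es ! r - lincomb (c r) (fs 1) \<in> I"
      by metis
    define A where "A = mat m m (\<lambda>(r, s). c r ! s)"
    have row: "list_of_vec (row A r) = c r" if "r < m" for r
      using that c(1)[OF that] by (intro nth_equalityI) (auto simp: A_def list_of_vec_index)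
    have "represents n I A (mult_var n I j) (shifted_basis n I es l i)
        (shifted_basis n I es l (i + 1))" for i
      unfolding represents_def
    proof (intro conjI allI impI)
      show "A \<in> carrier_mat (length (shifted_basis n I es l i)) (length (shifted_basis n I es l (i + 1)))"
        by (simp add: A_def shifted fs_def len)
      fix r assume "r < length (shifted_basis n I es l i)"
      then have r: "r < m" by (simp add: shifted fs_def len)
      have er: "es ! r * l ^ i \<in> carrier (mpoly_ring n)"
        using r len fsc[of i] by (simp add: fs_def image_subset_iff)
      \<comment> \<open>Multiplication by \<open>l ^ i\<close> turns \<open>fs 1\<close> into
        \<open>fs (i + 1)\<close> and keeps the coefficients \<open>c r\<close>.\<close>
      have "(mvar j * es ! r - lincomb (c r) (fs 1)) * l ^ i \<in> I"
        using c(2)[OF r] forms_carrier[OF lp] by (rule ideal_mpoly_closed[OF I.ideal_axioms])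
      also have "(mvar j * es ! r - lincomb (c r) (fs 1)) * l ^ i
          = mvar j * (es ! r * l ^ i) - lincomb (c r) (fs (i + 1))"
        by (simp add: fs_def lincomb_mult_right algebra_simps)
      finally have eq: "cls n I (mvar j * (es ! r * l ^ i)) = cls n I (lincomb (c r) (fs (i + 1)))"
        using I.cls_eq_iff carrier_mpoly_mult[OF jc er] lincomb_carrier[OF fsc] by blast
      have "mult_var n I j (shifted_basis n I es l i ! r) = cls n I (mvar j * (es ! r * l ^ i))"
        using r len by (simp add: I.cls_mult[OF jc er] mult_var_def shifted_basis_def)
      also note eq
      finally show "mult_var n I j (shifted_basis n I es l i ! r) =
          ring.combine (quot n I) (map (\<lambda>c. cls n I (mconst c)) (list_of_vec (row A r)))
            (shifted_basis n I es l (i + 1))"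
        by (simp only: row[OF r] shifted I.combine_cls[OF fsc])
    qed
    then show ?thesis by blast
  qed
  then show ?thesis using basis by blast
qed

end
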